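(* For every positive integer $n$, the graph $\Phi(\mathbb H(\mathbb Z_{2^n}))$ is connected, its diameter equals $2$, and its radius equals $1$.
   Context: For a positive integer $m$, $\mathbb Z_m$ denotes the integers modulo $m$, and $\mathbb H(\mathbb Z_m)$ denotes the ring of Hamilton quaternions over $\mathbb Z_m$: its elements are $a_1+a_2i+a_3j+a_4k$ with $a_1,a_2,a_3,a_4\in\mathbb Z_m$, written $(a_1,a_2,a_3,a_4)$. Addition is coordinatewise, and multiplication is determined by distributivity, scalars commuting with $i,j,k$, and $i^2=j^2=k^2=-1$, $ij=-ji=k$, $jk=-kj=i$, $ki=-ik=j$. Explicitly, $(a_1,a_2,a_3,a_4)(b_1,b_2,b_3,b_4)=(a_1b_1-a_2b_2-a_3b_3-a_4b_4,\ a_2b_1+a_1b_2-a_4b_3+a_3b_4,\ a_3b_1+a_4b_2+a_1b_3-a_2b_4,\ a_4b_1-a_3b_2+a_2b_3+a_1b_4)$. For a ring $R$ with unity, the non-zero divisor graph $\Phi(R)$ is the simple graph with vertex set $R\setminus\{0,1,-1\}$ in which two distinct vertices $x,y$ are adjacent if and only if $xy\neq 0$ or $yx\neq 0$. *)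

theory Defs
  imports "HOL-Number_Theory.Residues" "Graph_Theory.Graph_Theory"
begin

text \<open>The tuple \<open>(a1, a2, a3, a4)\<close> stands for \<open>a1 + a2 i + a3 j + a4 k\<close>.\<close>

definition quaternion_ring :: "('a, 'b) ring_scheme \<Rightarrow> ('a \<times> 'a \<times> 'a \<times> 'a) ring"
  where
    "quaternion_ring R =
      \<lparr>carrier = carrier R \<times> carrier R \<times> carrier R \<times> carrier R,
       monoid.mult = (\<lambda>(a1, a2, a3, a4) (b1, b2, b3, b4).
         (a1 \<otimes>\<^bsub>R\<^esub> b1 \<ominus>\<^bsub>R\<^esub> a2 \<otimes>\<^bsub>R\<^esub> b2 \<ominus>\<^bsub>R\<^esub> a3 \<otimes>\<^bsub>R\<^esub> b3 \<ominus>\<^bsub>R\<^esub> a4 \<otimes>\<^bsub>R\<^esub> b4,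
          a2 \<otimes>\<^bsub>R\<^esub> b1 \<oplus>\<^bsub>R\<^esub> a1 \<otimes>\<^bsub>R\<^esub> b2 \<ominus>\<^bsub>R\<^esub> a4 \<otimes>\<^bsub>R\<^esub> b3 \<oplus>\<^bsub>R\<^esub> a3 \<otimes>\<^bsub>R\<^esub> b4,
          a3 \<otimes>\<^bsub>R\<^esub> b1 \<oplus>\<^bsub>R\<^esub> a4 \<otimes>\<^bsub>R\<^esub> b2 \<oplus>\<^bsub>R\<^esub> a1 \<otimes>\<^bsub>R\<^esub> b3 \<ominus>\<^bsub>R\<^esub> a2 \<otimes>\<^bsub>R\<^esub> b4,
          a4 \<otimes>\<^bsub>R\<^esub> b1 \<ominus>\<^bsub>R\<^esub> a3 \<otimes>\<^bsub>R\<^esub> b2 \<oplus>\<^bsub>R\<^esub> a2 \<otimes>\<^bsub>R\<^esub> b3 \<oplus>\<^bsub>R\<^esub> a1 \<otimes>\<^bsub>R\<^esub> b4)),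
       one = (\<one>\<^bsub>R\<^esub>, \<zero>\<^bsub>R\<^esub>, \<zero>\<^bsub>R\<^esub>, \<zero>\<^bsub>R\<^esub>),
       zero = (\<zero>\<^bsub>R\<^esub>, \<zero>\<^bsub>R\<^esub>, \<zero>\<^bsub>R\<^esub>, \<zero>\<^bsub>R\<^esub>),
       add = (\<lambda>(a1, a2, a3, a4) (b1, b2, b3, b4).
         (a1 \<oplus>\<^bsub>R\<^esub> b1, a2 \<oplus>\<^bsub>R\<^esub> b2, a3 \<oplus>\<^bsub>R\<^esub> b3, a4 \<oplus>\<^bsub>R\<^esub> b4))\<rparr>"

lemma (in cring) ring_quaternion_ring: "ring (quaternion_ring R)"
proof (rule ringI)
  show "abelian_group (quaternion_ring R)"
  proof (rule abelian_groupI)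
    fix x assume "x \<in> carrier (quaternion_ring R)"
    then obtain a b c d where "x = (a, b, c, d)"
      "a \<in> carrier R" "b \<in> carrier R" "c \<in> carrier R" "d \<in> carrier R"
      by (auto simp: quaternion_ring_def)
    then show "\<exists>y\<in>carrier (quaternion_ring R).
        y \<oplus>\<^bsub>quaternion_ring R\<^esub> x = \<zero>\<^bsub>quaternion_ring R\<^esub>"
      by (intro bexI[of _ "(\<ominus> a, \<ominus> b, \<ominus> c, \<ominus> d)"]) (auto simp: quaternion_ring_def l_neg)
  qed (auto simp: quaternion_ring_def a_ac)
  show "monoid (quaternion_ring R)"
    by (rule monoidI; clarsimp simp: quaternion_ring_def) (simp_all add: ring_simprules)
qed (clarsimp simp: quaternion_ring_def; simp add: ring_simprules)+

text \<open>A simple graph is represented by the symmetric loop-free digraph on the same vertices that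
  has both arcs \<open>(x, y)\<close> and \<open>(y, x)\<close> for every edge.\<close>

definition non_zero_divisor_graph :: "('a, 'b) ring_scheme \<Rightarrow> ('a, 'a \<times> 'a) pre_digraph"
  where
    "non_zero_divisor_graph R =
      (let V = carrier R - {\<zero>\<^bsub>R\<^esub>, \<one>\<^bsub>R\<^esub>, \<ominus>\<^bsub>R\<^esub> \<one>\<^bsub>R\<^esub>}
       in with_proj
         \<lparr>pverts = V,
          parcs = {(x, y). x \<in> V \<and> y \<in> V \<and> x \<noteq> y \<and>
            (x \<otimes>\<^bsub>R\<^esub> y \<noteq> \<zero>\<^bsub>R\<^esub> \<or> y \<otimes>\<^bsub>R\<^esub> x \<noteq> \<zero>\<^bsub>R\<^esub>)}\<rparr>)"

lemma graph_non_zero_divisor_graph: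
  assumes "finite (carrier R)"
  shows "graph (non_zero_divisor_graph R)"
proof -
  let ?V = "carrier R - {\<zero>\<^bsub>R\<^esub>, \<one>\<^bsub>R\<^esub>, \<ominus>\<^bsub>R\<^esub> \<one>\<^bsub>R\<^esub>}"
  let ?A = "{(x, y). x \<in> ?V \<and> y \<in> ?V \<and> x \<noteq> y \<and>
    (x \<otimes>\<^bsub>R\<^esub> y \<noteq> \<zero>\<^bsub>R\<^esub> \<or> y \<otimes>\<^bsub>R\<^esub> x \<noteq> \<zero>\<^bsub>R\<^esub>)}"
  have "finite ?A"
    by (rule finite_subset[of _ "carrier R \<times> carrier R"]) (use assms in auto)
  then have "pair_graph \<lparr>pverts = ?V, parcs = ?A\<rparr>"
    using assms by unfold_locales (auto simp: symmetric_def sym_def)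
  then show ?thesis
    unfolding non_zero_divisor_graph_def Let_def
    by (rule pair_graph.pair_graphD_graph)
qed

text \<open>The distance is \<open>\<infinity>\<close> if no walk joins the two vertices.\<close>

definition graph_distance :: "('a, 'b) pre_digraph \<Rightarrow> 'a \<Rightarrow> 'a \<Rightarrow> enat"
  where "graph_distance G u v = (INF p\<in>{p. pre_digraph.awalk G u p v}. enat (length p))"

definition graph_eccentricity :: "('a, 'b) pre_digraph \<Rightarrow> 'a \<Rightarrow> enat"
  where "graph_eccentricity G u = (SUP v\<in>verts G. graph_distance G u v)"

definition graph_diameter :: "('a, 'b) pre_digraph \<Rightarrow> enat"
  where "graph_diameter G = (SUP u\<in>verts G. graph_eccentricity G u)"

definition graph_radius :: "('a, 'b) pre_digraph \<Rightarrow> enat"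
  where "graph_radius G = (INF u\<in>verts G. graph_eccentricity G u)"

end

theory Submission
  imports Defs
begin

text \<open>The quaternion \<open>i\<close> is a unit different from \<open>0\<close>, \<open>1\<close> and \<open>- 1\<close>, and a unit annihilates no
  nonzero element, so \<open>i\<close> is adjacent to all other vertices. Hence the graph is connected with radius
  \<open>1\<close> and diameter at most \<open>2\<close>. With \<open>h = 2 ^ (n - 1)\<close>, for which \<open>h + h = 0\<close>, the vertices
  \<open>h (1 + i)\<close> and \<open>h (1 + i + j + k)\<close> are not adjacent: their products are \<open>2 h\<^sup>2 (i + k)\<close> and
  \<open>2 h\<^sup>2 (i + j)\<close>, both of which vanish.\<close>

context wf_digraph
begin

lemma graph_distance_le: "awalk u p v \<Longrightarrow> graph_distance G u v \<le> enat (length p)"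
  unfolding graph_distance_def by (rule INF_lower) simp

lemma graph_distance_ge_1:
  assumes "u \<noteq> v"
  shows "1 \<le> graph_distance G u v"
  unfolding graph_distance_def
proof (rule INF_greatest)
  fix p assume "p \<in> {p. awalk u p v}"
  with assms have "p \<noteq> []" by (auto simp: awalk_Nil_iff)
  then show "1 \<le> enat (length p)" by (simp add: one_enat_def Suc_le_eq)
qed

text \<open>An empty walk would force \<open>u = v\<close>, and the arc of a one-arc walk would
  witness adjacency.\<close>

lemma graph_distance_ge_2:
  assumes "u \<noteq> v" "\<not> u \<rightarrow>\<^bsub>G\<^esub> v"
  shows "2 \<le> graph_distance G u v"
  unfolding graph_distance_def
proof (rule INF_greatest)
  fix p assume "p \<in> {p. awalk u p v}"
  then have p: "awalk u p v" by simp
  have "2 \<le> length p"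
  proof (cases p)
    case Nil
    with p assms show ?thesis by (auto simp: awalk_Nil_iff)
  next
    case (Cons e q)
    with p assms have "q \<noteq> []"
      by (auto simp: awalk_simps arcs_ends_def arc_to_ends_def)
    with Cons show ?thesis by (cases q) auto
  qed
  then show "2 \<le> enat (length p)" by (simp add: numeral_eq_enat)
qed

text \<open>The empty walk exists only at vertices; elsewhere the infimum ranges over no walks and
  is infinite.\<close>

lemma graph_distance_self: "u \<in> verts G \<Longrightarrow> graph_distance G u u = 0"
  using graph_distance_le[of u "[]" u] by (simp add: awalk_Nil_iff zero_enat_def[symmetric])

lemma graph_distance_adj_le:
  assumes "u \<rightarrow>\<^bsub>G\<^esub> v"
  shows "graph_distance G u v \<le> 1"
proof -
  from assms obtain e where "e \<in> arcs G" "tail G e = u" "head G e = v"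
    by (auto simp: arcs_ends_def arc_to_ends_def)
  then have "awalk u [e] v" using arc_implies_awalk[of e] by simp
  from graph_distance_le[OF this] show ?thesis by (simp add: one_enat_def)
qed

lemma graph_distance_adj_adj_le:
  assumes "u \<rightarrow>\<^bsub>G\<^esub> v" "v \<rightarrow>\<^bsub>G\<^esub> w"
  shows "graph_distance G u w \<le> 2"
proof -
  from assms obtain e f where "e \<in> arcs G" "tail G e = u" "head G e = v"
    and "f \<in> arcs G" "tail G f = v" "head G f = w"
    by (auto simp: arcs_ends_def arc_to_ends_def)
  then have "awalk u [e, f] w" by (auto simp: awalk_simps)
  from graph_distance_le[OF this] show ?thesis by (simp add: numeral_eq_enat numeral_2_eq_2)
qed

end

context sym_digraph
begin

lemma adj_sym: "u \<rightarrow>\<^bsub>G\<^esub> v \<Longrightarrow> v \<rightarrow>\<^bsub>G\<^esub> u"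
  using sym_arcs by (auto simp: symmetric_def sym_def)

context
  fixes c
  assumes c: "c \<in> verts G" and dominating: "\<And>v. v \<in> verts G \<Longrightarrow> v \<noteq> c \<Longrightarrow> c \<rightarrow>\<^bsub>G\<^esub> v"
begin

lemma connected_if_dominating: "connected G"
proof (rule connectedI)
  show "verts G \<noteq> {}" using c by auto
  fix u v assume uv: "u \<in> verts G" "v \<in> verts G"
  have "u \<rightarrow>\<^sup>* c" using uv c dominating adj_sym by (cases "u = c") auto
  also have "c \<rightarrow>\<^sup>* v" using uv c dominating by (cases "v = c") auto
  finally have "u \<rightarrow>\<^sup>* v" .
  \<comment> \<open>Connectedness of a digraph refers to its symmetric closure, which inherits
    reachability from \<open>G\<close>.\<close>
  then show "u \<rightarrow>\<^sup>*\<^bsub>mk_symmetric G\<^esub> v" by (rule reachable_mk_symmetricI)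
qed

text \<open>Distinct vertices other than \<open>c\<close> are joined by the detour through
  \<open>c\<close>; if one of them is \<open>c\<close>, a single arc suffices.\<close>

lemma graph_distance_le_2_if_dominating:
  assumes "u \<in> verts G" "v \<in> verts G"
  shows "graph_distance G u v \<le> 2"
proof (cases "u = v")
  case True
  then show ?thesis using assms by (simp add: graph_distance_self)
next
  case False
  have "(1::enat) \<le> 2" by simp
  then have "graph_distance G u v \<le> 2" if "u \<rightarrow>\<^bsub>G\<^esub> v"
    using graph_distance_adj_le[OF that] by (rule order_trans[rotated])
  then show ?thesis
    using False assms dominating adj_sym graph_distance_adj_adj_le[of u c v]
    by (cases "u = c"; cases "v = c") auto
qed

lemma graph_diameter_eq_2_if_dominating:
  assumes uv: "u \<in> verts G" "v \<in> verts G" "u \<noteq> v" "\<not> u \<rightarrow>\<^bsub>G\<^esub> v"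
  shows "graph_diameter G = 2"
proof (rule antisym)
  show "graph_diameter G \<le> 2"
    unfolding graph_diameter_def graph_eccentricity_def
    by (intro SUP_least graph_distance_le_2_if_dominating)
  have "2 \<le> graph_distance G u v" using uv by (intro graph_distance_ge_2)
  also have "\<dots> \<le> graph_eccentricity G u"
    unfolding graph_eccentricity_def using uv by (intro SUP_upper)
  also have "\<dots> \<le> graph_diameter G"
    unfolding graph_diameter_def using uv by (intro SUP_upper)
  finally show "2 \<le> graph_diameter G" .
qed

lemma graph_radius_eq_1_if_dominating:
  assumes uv: "u \<in> verts G" "v \<in> verts G" "u \<noteq> v"
  shows "graph_radius G = 1"
proof (rule antisym)
  have "graph_distance G c w \<le> 1" if "w \<in> verts G" for w
    using that dominating graph_distance_adj_le by (cases "w = c") (auto simp: graph_distance_self)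
  then have "graph_eccentricity G c \<le> 1"
    unfolding graph_eccentricity_def by (rule SUP_least)
  then show "graph_radius G \<le> 1"
    unfolding graph_radius_def using c by (rule INF_lower2[rotated])
  show "1 \<le> graph_radius G"
    unfolding graph_radius_def
  proof (rule INF_greatest)
    fix w assume "w \<in> verts G"
    \<comment> \<open>Since \<open>w\<close> cannot equal both \<open>u\<close> and
      \<open>v\<close>, one of them serves as \<open>w'\<close>.\<close>
    from uv obtain w' where w': "w' \<in> verts G" "w \<noteq> w'" by metis
    then have "1 \<le> graph_distance G w w'" by (intro graph_distance_ge_1)
    also have "\<dots> \<le> graph_eccentricity G w"
      unfolding graph_eccentricity_def using w' by (intro SUP_upper)
    finally show "1 \<le> graph_eccentricity G w" .
  qed
qed

end

end

lemma verts_non_zero_divisor_graph: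
  "verts (non_zero_divisor_graph R) = carrier R - {\<zero>\<^bsub>R\<^esub>, \<one>\<^bsub>R\<^esub>, \<ominus>\<^bsub>R\<^esub> \<one>\<^bsub>R\<^esub>}"
  by (simp add: non_zero_divisor_graph_def Let_def)

lemma adj_non_zero_divisor_graph_iff:
  "x \<rightarrow>\<^bsub>non_zero_divisor_graph R\<^esub> y \<longleftrightarrow>
    x \<in> verts (non_zero_divisor_graph R) \<and> y \<in> verts (non_zero_divisor_graph R) \<and> x \<noteq> y \<and>
    (x \<otimes>\<^bsub>R\<^esub> y \<noteq> \<zero>\<^bsub>R\<^esub> \<or> y \<otimes>\<^bsub>R\<^esub> x \<noteq> \<zero>\<^bsub>R\<^esub>)"
  by (auto simp: non_zero_divisor_graph_def Let_def arcs_ends_def arc_to_ends_def)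

lemma (in ring) Units_adj_non_zero_divisor_graph:
  assumes "c \<in> Units R" "c \<in> verts (non_zero_divisor_graph R)"
    "x \<in> verts (non_zero_divisor_graph R)" "x \<noteq> c"
  shows "c \<rightarrow>\<^bsub>non_zero_divisor_graph R\<^esub> x"
proof -
  have x: "x \<in> carrier R" "x \<noteq> \<zero>" using assms by (auto simp: verts_non_zero_divisor_graph)
  have "c \<otimes> x \<noteq> \<zero>"
  proof
    assume "c \<otimes> x = \<zero>"
    then have "c \<otimes> x = c \<otimes> \<zero>" using Units_closed[OF assms(1)] by simp
    then show False using x assms(1) by simp
  qed
  then show ?thesis using assms by (auto simp: adj_non_zero_divisor_graph_iff)
qed

context cring
begin

text \<open>Negation is not a field of the ring record but is derived from addition, so the value is
  identified by uniqueness of additive inverses.\<close>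

lemma quaternion_ring_uminus_one:
  "\<ominus>\<^bsub>quaternion_ring R\<^esub> \<one>\<^bsub>quaternion_ring R\<^esub> = (\<ominus> \<one>, \<zero>, \<zero>, \<zero>)"
proof -
  interpret Q: ring "quaternion_ring R" by (rule ring_quaternion_ring)
  show ?thesis by (rule Q.minus_equality) (auto simp: quaternion_ring_def l_neg)
qed

lemma verts_non_zero_divisor_graph_quaternion_ring:
  "verts (non_zero_divisor_graph (quaternion_ring R)) =
    carrier R \<times> carrier R \<times> carrier R \<times> carrier R -
      {(\<zero>, \<zero>, \<zero>, \<zero>), (\<one>, \<zero>, \<zero>, \<zero>), (\<ominus> \<one>, \<zero>, \<zero>, \<zero>)}"
  unfolding verts_non_zero_divisor_graph quaternion_ring_uminus_one
  by (simp add: quaternion_ring_def)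

text \<open>As the square of \<open>i\<close> is \<open>- 1\<close>, its inverse is
  \<open>- i\<close>.\<close>

lemma quaternion_i_in_Units: "(\<zero>, \<one>, \<zero>, \<zero>) \<in> Units (quaternion_ring R)"
proof -
  let ?i = "(\<zero>, \<one>, \<zero>, \<zero>)" and ?i' = "(\<zero>, \<ominus> \<one>, \<zero>, \<zero>)"
  have "?i' \<in> carrier (quaternion_ring R)" "?i \<in> carrier (quaternion_ring R)"
    "?i' \<otimes>\<^bsub>quaternion_ring R\<^esub> ?i = \<one>\<^bsub>quaternion_ring R\<^esub>"
    "?i \<otimes>\<^bsub>quaternion_ring R\<^esub> ?i' = \<one>\<^bsub>quaternion_ring R\<^esub>"
    by (simp_all add: quaternion_ring_def minus_eq l_minus r_minus)
  then show ?thesis unfolding Units_def by blast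
qed

text \<open>All that is taken from the integers modulo a power of two is a finite commutative ring
  with an element \<open>h\<close> of additive order two.\<close>

theorem non_zero_divisor_graph_quaternion_ring:
  assumes fin: "finite (carrier R)"
    and h: "h \<in> carrier R" "h \<noteq> \<zero>" "h \<oplus> h = \<zero>"
  defines "G \<equiv> non_zero_divisor_graph (quaternion_ring R)"
  shows "connected G \<and> graph_diameter G = 2 \<and> graph_radius G = 1"
proof -
  interpret Q: ring "quaternion_ring R" by (rule ring_quaternion_ring)
  have "finite (carrier (quaternion_ring R))"
    using fin by (simp add: quaternion_ring_def)
  then interpret G: graph G
    unfolding G_def by (rule graph_non_zero_divisor_graph)
  \<comment> \<open>In the trivial ring \<open>h\<close> would be zero. The second coordinate now
    separates \<open>i\<close> from \<open>0\<close>, \<open>1\<close> and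
    \<open>- 1\<close>.\<close>
  have "\<one> \<noteq> \<zero>" using h one_zeroD by auto
  then have i: "(\<zero>, \<one>, \<zero>, \<zero>) \<in> verts G"
    by (simp add: G_def verts_non_zero_divisor_graph_quaternion_ring)
  have dominating: "(\<zero>, \<one>, \<zero>, \<zero>) \<rightarrow>\<^bsub>G\<^esub> v" if "v \<in> verts G" "v \<noteq> (\<zero>, \<one>, \<zero>, \<zero>)" for v
    using Q.Units_adj_non_zero_divisor_graph quaternion_i_in_Units i that by (simp add: G_def)
  let ?x = "(h, h, \<zero>, \<zero>)" and ?y = "(h, h, h, h)"
  \<comment> \<open>As \<open>h\<close> is nonzero, the second coordinate excludes \<open>0\<close>,
    \<open>1\<close> and \<open>- 1\<close>, and the third tells the two vertices apart.\<close>
  have xy: "?x \<in> verts G" "?y \<in> verts G" "?x \<noteq> ?y"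
    using h by (auto simp: G_def verts_non_zero_divisor_graph_quaternion_ring)
  have "h \<otimes> h \<oplus> h \<otimes> h = h \<otimes> (h \<oplus> h)" using h(1) by (simp add: r_distr)
  then have hh: "h \<otimes> h \<oplus> h \<otimes> h = \<zero>" using h by simp
  \<comment> \<open>Each coordinate of either product reduces to \<open>h \<otimes> h\<close> minus
    itself or plus itself.\<close>
  have "\<not> ?x \<rightarrow>\<^bsub>G\<^esub> ?y"
    using h(1) hh unfolding G_def adj_non_zero_divisor_graph_iff
    by (simp add: quaternion_ring_def minus_eq r_neg)
  with xy i dominating show ?thesis
    using G.connected_if_dominating G.graph_diameter_eq_2_if_dominating
      G.graph_radius_eq_1_if_dominating by blast
qed

end

theorem theorem4p2:
  fixes n :: nat
  assumes "n > 0"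
  shows "connected (non_zero_divisor_graph (quaternion_ring (residue_ring (2 ^ n)))) \<and>
    graph_diameter (non_zero_divisor_graph (quaternion_ring (residue_ring (2 ^ n)))) = 2 \<and>
    graph_radius (non_zero_divisor_graph (quaternion_ring (residue_ring (2 ^ n)))) = 1"
proof -
  obtain m where n: "n = Suc m" using assms gr0_conv_Suc by blast
  \<comment> \<open>The locale requires a modulus greater than 1, which holds because
    \<open>n\<close> is positive.\<close>
  interpret residues "2 ^ n" "residue_ring (2 ^ n)"
    by unfold_locales (use assms in simp_all)
  show ?thesis
  proof (rule non_zero_divisor_graph_quaternion_ring)
    \<comment> \<open>The witness \<open>h\<close> is \<open>2 ^ m\<close> with
      \<open>m = n - 1\<close>: it lies strictly between \<open>0\<close> and \<open>2 ^ n\<close>,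
      and its double is the modulus.\<close>
    show "(2 ^ m :: int) \<in> carrier (residue_ring (2 ^ n))"
      by (simp add: residue_ring_def n)
  qed (simp_all add: residue_ring_def n)
qed

end
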